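(* The Gersten–Short geodesics do not fellow travel in the flat $F$: there is no constant $k$ such that every two Gersten–Short geodesics in $F$ that start at distance at most one apart and end at distance at most one apart $k$-fellow travel.
   Context: A triangle-square complex is a complex obtained by gluing unit equilateral triangles and unit squares isometrically along edges. The flat $F$: let $\mathcal{E}$ be the Euclidean plane $\mathbb{C}$ tiled by unit equilateral triangles with vertex set the Eisenstein integers, and let $r_0,\dots,r_5$ be the six distinct rays starting at $0$ contained in the $1$-skeleton of $\mathcal{E}$. $F$ is obtained from $\mathcal{E}$ by replacing each ray $r_i$ by a half-strip $[0,\infty)\times[0,1]$ tiled by unit squares and replacing the vertex $0$ by a unit regular hexagon triangulated by six unit equilateral triangles. (So $F$ is a plane consisting of a central unit hexagon, six half-strips of squares attached perpendicularly to its sides, and six triangulated sectors of angle $\pi/3$, each between two consecutive half-strips with its apex at a vertex of the hexagon.) Paths: a path in a graph is a finite sequence $e_1,\dots,e_n$ of oriented edges such that the final vertex of $e_i$ is the initial vertex of $e_{i+1}$; its length is $n$. The $i$-th vertex $\gamma^{(v)}_i$ of a path $\gamma$ is the initial vertex of $e_{i+1}$ for $i<n$ and the terminal vertex of $e_n$ for $i\ge n$. Two paths $\gamma,\eta$ $k$-fellow travel if $d(\gamma^{(v)}_i,\eta^{(v)}_i)\le k$ for all natural $i\le\max(\mathrm{len}(\gamma),\mathrm{len}(\eta))$, where $d$ is the graph distance. Here all paths and distances are in the $1$-skeleton of $F$. Gersten–Short geodesics: let $X$ be a CAT(0) triangle-square complex and $v,u$ vertices of $X$. It is known that, if $v\ne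 u$, the set of all geodesic paths from $v$ to $u$ in the $1$-skeleton of $X$ satisfies one of the following, each of which determines a vertex $v'$: (i) all geodesic paths from $v$ to $u$ have the same first edge $e$; then $v'$ is the endpoint of $e$ other than $v$. (ii) There are two edges $e,e'$ of a single square cell $S$ such that the first edge of each geodesic path is $e$ or $e'$; then $v'$ is the vertex of $S$ not belonging to $e$ or $e'$, and there are geodesic paths from $v$ to $u$ passing through $e$ and then $v'$, and through $e'$ and then $v'$. (iii) There are two edges $e,e'$ of a single triangle cell $T$ such that the first edge of each geodesic path is $e$ or $e'$; then there are a triangle $T'$ and a finite, possibly empty, row of squares with $T$ and $T'$ at its two ends (the edge of $T$ opposite to $v$ is one end edge of the row and an edge of $T'$ is the other end edge; if the row is empty, $T$ and $T'$ share that edge), and $v'$ is the vertex of $T'$ not belonging to the row; there are geodesic paths from $v$ to $u$ travelling along either side of the region formed by $T$, the row of squares and $T'$, passing through $v'$. The set of choke points between $v$ and $u$ is defined recursively: it is $\{v\}$ if $v=u$, and otherwise it is the union of $\{v\}$ and the set of choke points between $v'$ and $u$. A Gersten–Short geodesic between $v$ and $u$ is a geodesic path from $v$ to $u$ in the $1$-skeleton passing through all the choke points between $v$ and $u$. *)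

theory Defs
  imports "Graph_Theory.Graph_Theory" "HOL-Library.Sublist"
begin

(* Combinatorial triangle-square complexes.  In the CAT(0) case an edge or a cell is determined
   by its set of vertices, so edges, triangles and squares are recorded as vertex sets of
   cardinality 2, 3 and 4.  The sides of a cell are the edges of the complex contained in it;
   in particular the diagonals of a square must not be edges. *)

record 'a ts_complex =
  vertices :: "'a set"
  edges :: "'a set set"
  triangles :: "'a set set"
  squares :: "'a set set"

(* Every edge gives two opposite arcs, the oriented edges.  A path with initial vertex v is
   then an awalk in this digraph, i.e. a list of consecutive arcs; the initial vertex is
   carried along because the list may be empty. *)

definition skeleton :: "'a ts_complex \<Rightarrow> ('a, 'a \<times> 'a) pre_digraph" where
  "skeleton X = \<lparr>verts = vertices X, arcs = {(x, y). {x, y} \<in> edges X}, tail = fst, head = snd\<rparr>"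

abbreviation edge_path :: "'a ts_complex \<Rightarrow> 'a \<Rightarrow> ('a \<times> 'a) list \<Rightarrow> 'a \<Rightarrow> bool" where
  "edge_path X \<equiv> pre_digraph.awalk (skeleton X)"

abbreviation path_verts :: "'a ts_complex \<Rightarrow> 'a \<Rightarrow> ('a \<times> 'a) list \<Rightarrow> 'a list" where
  "path_verts X \<equiv> pre_digraph.awalk_verts (skeleton X)"

definition gdist :: "'a ts_complex \<Rightarrow> 'a \<Rightarrow> 'a \<Rightarrow> ereal" where
  "gdist X = wf_digraph.\<mu> (skeleton X) (\<lambda>_. 1)"

definition geodesic :: "'a ts_complex \<Rightarrow> 'a \<Rightarrow> ('a \<times> 'a) list \<Rightarrow> 'a \<Rightarrow> bool" where
  "geodesic X v p u \<longleftrightarrow> edge_path X v p u \<and> ereal (real (length p)) = gdist X v u"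

definition path_vertex :: "'a ts_complex \<Rightarrow> 'a \<Rightarrow> ('a \<times> 'a) list \<Rightarrow> nat \<Rightarrow> 'a" where
  "path_vertex X v p i = path_verts X v p ! min i (length p)"

definition fellow_travel ::
  "'a ts_complex \<Rightarrow> real \<Rightarrow> 'a \<Rightarrow> ('a \<times> 'a) list \<Rightarrow> 'a \<Rightarrow> ('a \<times> 'a) list \<Rightarrow> bool" where
  "fellow_travel X k v p w q \<longleftrightarrow>
     (\<forall>i \<le> max (length p) (length q). gdist X (path_vertex X v p i) (path_vertex X w q i) \<le> ereal k)"

definition first_edges :: "'a ts_complex \<Rightarrow> 'a \<Rightarrow> 'a \<Rightarrow> ('a \<times> 'a) set" where
  "first_edges X v u = {hd p | p. geodesic X v p u}"

definition geodesic_along :: "'a ts_complex \<Rightarrow> 'a list \<Rightarrow> 'a \<Rightarrow> 'a \<Rightarrow> bool" where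
  "geodesic_along X vs v u \<longleftrightarrow> (\<exists>p. geodesic X v p u \<and> prefix vs (path_verts X v p))"

(* A row of m squares with sides xs = [x_0, ..., x_m] and ys = [y_0, ..., y_m]: the j-th square
   has vertices x_(j-1), y_(j-1), x_j, y_j, and the end edges of the row are {x_0, y_0} and
   {x_m, y_m}.  The empty row (m = 0) is a single edge. *)

definition square_row :: "'a ts_complex \<Rightarrow> 'a list \<Rightarrow> 'a list \<Rightarrow> bool" where
  "square_row X xs ys \<longleftrightarrow>
     xs \<noteq> [] \<and> length xs = length ys \<and> distinct (xs @ ys) \<and>
     (\<forall>i < length xs. {xs ! i, ys ! i} \<in> edges X) \<and>
     (\<forall>i. Suc i < length xs \<longrightarrow>
        {xs ! i, xs ! Suc i} \<in> edges X \<and> {ys ! i, ys ! Suc i} \<in> edges X \<and>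
        {xs ! i, ys ! i, xs ! Suc i, ys ! Suc i} \<in> squares X)"

(* next_choke X v u v': v' is the vertex determined by the geodesics from v to u (v \<noteq> u),
   with the three cases "same first edge", "square" and "triangle, row of squares, triangle". *)

inductive next_choke :: "'a ts_complex \<Rightarrow> 'a \<Rightarrow> 'a \<Rightarrow> 'a \<Rightarrow> bool"
  for X v u where
  same_edge:
    "first_edges X v u = {(v, v')} \<Longrightarrow> next_choke X v u v'"
| square:
    "{v, x, y, v'} \<in> squares X \<Longrightarrow> distinct [v, x, y, v'] \<Longrightarrow>
     {v, x} \<in> edges X \<Longrightarrow> {v, y} \<in> edges X \<Longrightarrow>
     first_edges X v u \<subseteq> {(v, x), (v, y)} \<Longrightarrow>
     geodesic_along X [v, x, v'] v u \<Longrightarrow> geodesic_along X [v, y, v'] v u \<Longrightarrow>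
     next_choke X v u v'"
| triangle:
    "square_row X xs ys \<Longrightarrow>
     {v, hd xs, hd ys} \<in> triangles X \<Longrightarrow> v \<notin> {hd xs, hd ys} \<Longrightarrow>
     {last xs, last ys, v'} \<in> triangles X \<Longrightarrow> v' \<notin> {last xs, last ys} \<Longrightarrow>
     {v, hd xs, hd ys} \<noteq> {last xs, last ys, v'} \<Longrightarrow>
     first_edges X v u \<subseteq> {(v, hd xs), (v, hd ys)} \<Longrightarrow>
     geodesic_along X (v # xs @ [v']) v u \<Longrightarrow> geodesic_along X (v # ys @ [v']) v u \<Longrightarrow>
     next_choke X v u v'"

inductive choke_point :: "'a ts_complex \<Rightarrow> 'a \<Rightarrow> 'a \<Rightarrow> 'a \<Rightarrow> bool"
  for X and u where
  start: "choke_point X u v v"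
| step: "v \<noteq> u \<Longrightarrow> next_choke X v u v' \<Longrightarrow> choke_point X u v' w \<Longrightarrow> choke_point X u v w"

definition choke_points :: "'a ts_complex \<Rightarrow> 'a \<Rightarrow> 'a \<Rightarrow> 'a set" where
  "choke_points X v u = {w. choke_point X u v w}"

definition gersten_short :: "'a ts_complex \<Rightarrow> 'a \<Rightarrow> ('a \<times> 'a) list \<Rightarrow> 'a \<Rightarrow> bool" where
  "gersten_short X v p u \<longleftrightarrow> geodesic X v p u \<and> choke_points X v u \<subseteq> set (path_verts X v p)"

(* The flat F.  Write z = exp(i pi/3) and let the rays of the Eisenstein tiling be r_k = [0,oo) z^k,
   k < 6.  Cutting the plane along the rays gives six sectors; Pt k a b is the Eisenstein
   integer a z^k + b z^(k+1) of the closed sector between r_k and r_(k+1).  Thus every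
   lattice point b z^(k+1), b > 0, of a ray occurs twice, as Pt k 0 b and as Pt (k+1) b 0, and
   these two copies are the two ends of a rung of the half-strip replacing the ray.  The point 0 occurs
   six times, as the corners Pt k 0 0 of the hexagon replacing it, whose centre is Center.
   Sector indices are taken modulo 6. *)

datatype F_vertex = Center | Pt nat nat nat

abbreviation next_sector :: "nat \<Rightarrow> nat" where
  "next_sector k \<equiv> (k + 1) mod 6"

definition flat_F :: "F_vertex ts_complex" where
  "flat_F = \<lparr>
     vertices = {Center} \<union> {Pt k a b | k a b. k < 6},
     edges =
       {{Center, Pt k 0 0} | k. k < 6} \<union>
       {{Pt k a b, Pt k (a + 1) b} | k a b. k < 6} \<union>
       {{Pt k a b, Pt k a (b + 1)} | k a b. k < 6} \<union>
       {{Pt k (a + 1) b, Pt k a (b + 1)} | k a b. k < 6} \<union>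
       \<comment> \<open>rungs of the half-strips; for b = 0 these are the sides of the hexagon\<close>
       {{Pt k 0 b, Pt (next_sector k) b 0} | k b. k < 6},
     triangles =
       {{Center, Pt k 0 0, Pt (next_sector k) 0 0} | k. k < 6} \<union>
       {{Pt k a b, Pt k (a + 1) b, Pt k a (b + 1)} | k a b. k < 6} \<union>
       {{Pt k (a + 1) b, Pt k a (b + 1), Pt k (a + 1) (b + 1)} | k a b. k < 6},
     squares =
       {{Pt k 0 b, Pt k 0 (b + 1), Pt (next_sector k) b 0, Pt (next_sector k) (b + 1) 0}
         | k b. k < 6}\<rparr>"

(* The shortest-path function underlying gdist is only specified for well-formed digraphs. *)

lemma wf_digraph_skeleton_flat_F: "wf_digraph (skeleton flat_F)"
  by unfold_locales (auto simp: skeleton_def flat_F_def doubleton_eq_iff)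

end

theory Submission
  imports Defs
begin

text \<open>
  Let \<open>m = 2 j\<close>. Consider two geodesics of \<open>F\<close> starting on the two sides of the half-strip of the
  ray \<open>z\<close> and ending on the two sides of the half-strip of the ray \<open>z\<^sup>3\<close>, always at distance \<open>m\<close>
  from the hexagon. From \<open>Pt 0 0 m\<close> to \<open>Pt 3 m 0\<close> there is only one geodesic, and it runs through
  the centre of the hexagon: a detour around it would cross three strips, whereas passing through
  costs two edges. From \<open>Pt 1 m 0\<close> to \<open>Pt 2 0 m\<close> there is only the strip of the ray \<open>z\<^sup>2\<close> to cross,
  and the choke points follow the diagonal direction \<open>-1 - z\<close>, along which that strip is crossed
  at height \<open>j\<close>. After \<open>m\<close> steps the two geodesics are at \<open>Pt 0 0 0\<close> and at \<open>Pt 1 0 j\<close>.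

  Lower bounds for distances come from integer-valued 1-Lipschitz functions: linear functionals of
  the Eisenstein plane, corrected by a constant on each sector. A path along which such a function
  drops by one at every step is geodesic, and every geodesic between its endpoints descends in the
  same way.
\<close>

section \<open>Lipschitz functions and paths calibrated by them\<close>

definition lipschitz :: "'a ts_complex \<Rightarrow> ('a \<Rightarrow> int) \<Rightarrow> bool" where
  "lipschitz X f \<longleftrightarrow> (\<forall>x y. {x, y} \<in> edges X \<longrightarrow> f x \<le> f y + 1)"

text \<open>A step lowers the maximum only if both functions end below the old maximum, so in
  \<open>pot_centre\<close> one functional can veto descents of the other.\<close>

lemma lipschitz_max:
  "lipschitz X f \<Longrightarrow> lipschitz X g \<Longrightarrow> lipschitz X (\<lambda>x. max (f x) (g x))"
  unfolding lipschitz_def by (intro allI impI max.boundedI; simp add: le_max_iff_disj max_add_distrib_left)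

text \<open>The vertices are given by a function, so that a tail is a shift of \<open>h\<close> and
  a detour through another vertex is a function update.\<close>

definition chain :: "(nat \<Rightarrow> 'a) \<Rightarrow> nat \<Rightarrow> ('a \<times> 'a) list" where
  "chain h n = map (\<lambda>i. (h i, h (Suc i))) [0..<n]"

text \<open>A discrete calibration: a 1-Lipschitz \<open>f\<close> falls at the fastest possible
  rate along \<open>h\<close>, which certifies minimal length.\<close>

definition calibrated :: "'a ts_complex \<Rightarrow> ('a \<Rightarrow> int) \<Rightarrow> (nat \<Rightarrow> 'a) \<Rightarrow> nat \<Rightarrow> bool" where
  "calibrated X f h n \<longleftrightarrow>
     (\<forall>i<n. {h i, h (Suc i)} \<in> edges X \<and> f (h i) = f (h (Suc i)) + 1)"

lemma length_chain [simp]: "length (chain h n) = n"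
  by (simp add: chain_def)

lemma chain_Suc: "chain h (Suc n) = (h 0, h 1) # chain (\<lambda>i. h (Suc i)) n"
  by (simp add: chain_def map_upt_Suc del: upt_Suc)

lemma path_verts_chain: "path_verts X (h 0) (chain h n) = map h [0..<Suc n]"
proof (induction n arbitrary: h)
  case 0
  then show ?case by (simp add: chain_def pre_digraph.awalk_verts.simps)
next
  case (Suc n)
  show ?case
    using Suc[of "\<lambda>i. h (Suc i)"]
    by (simp add: chain_Suc pre_digraph.awalk_verts.simps skeleton_def map_upt_Suc del: upt_Suc)
qed

lemma path_vertex_chain: "i \<le> n \<Longrightarrow> path_vertex X (h 0) (chain h n) i = h i"
  by (simp add: path_vertex_def path_verts_chain nth_append)

lemma calibrated_shift: "calibrated X f h n \<Longrightarrow> calibrated X f (\<lambda>j. h (i + j)) (n - i)"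
  by (auto simp: calibrated_def)

lemma calibrated_drop: "calibrated X f h n \<Longrightarrow> f (h 0) = f (h n) + int n"
proof (induction n)
  case (Suc n)
  then have "calibrated X f h n" by (simp add: calibrated_def)
  with Suc show ?case by (simp add: calibrated_def)
qed simp

section \<open>Distances and first edges read off from calibrations\<close>

context
  fixes X :: "'a ts_complex"
  assumes wf: "wf_digraph (skeleton X)"
begin


interpretation wf_digraph "skeleton X" by (rule wf)

lemma skeleton_simps [simp]:
  "tail (skeleton X) = fst" "head (skeleton X) = snd" "verts (skeleton X) = vertices X"
  "(x, y) \<in> arcs (skeleton X) \<longleftrightarrow> {x, y} \<in> edges X"
  by (simp_all add: skeleton_def)

lemma edge_vertices:
  assumes "{x, y} \<in> edges X"
  shows "x \<in> vertices X" "y \<in> vertices X"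
proof -
  from assms have "(x, y) \<in> arcs (skeleton X)" by simp
  from tail_in_verts[OF this] head_in_verts[OF this]
  show "x \<in> vertices X" "y \<in> vertices X" by simp_all
qed

lemma awalk_cost_one: "awalk_cost (\<lambda>_. 1) p = real (length p)"
  by (induction p) simp_all

lemma gdist_le: "edge_path X v p u \<Longrightarrow> gdist X v u \<le> ereal (real (length p))"
  using min_cost_le_walk_cost[of v p u "\<lambda>_. 1"] by (simp add: gdist_def awalk_cost_one)

lemma lipschitz_path:
  assumes "lipschitz X f" "edge_path X v p u"
  shows "f v \<le> f u + int (length p)"
  using assms(2)
proof (induction p arbitrary: v)
  case Nil
  then show ?case by (simp add: awalk_Nil_iff)
next
  case (Cons e p)
  then have e: "{fst e, snd e} \<in> edges X" "fst e = v" and p: "edge_path X (snd e) p u"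
    by (cases e; simp add: awalk_Cons_iff)+
  from e assms(1) have "f v \<le> f (snd e) + 1" by (auto simp: lipschitz_def)
  with Cons.IH[OF p] show ?case by simp
qed

lemma lipschitz_gdist:
  assumes "lipschitz X f"
  shows "ereal (real_of_int (f v - f u)) \<le> gdist X v u"
  unfolding gdist_def \<mu>_def
proof (rule INF_greatest)
  fix p assume "p \<in> {p. edge_path X v p u}"
  then have "f v \<le> f u + int (length p)" using lipschitz_path[OF assms] by simp
  then show "ereal (real_of_int (f v - f u)) \<le> ereal (awalk_cost (\<lambda>_. 1) p)"
    by (simp add: awalk_cost_one)
qed

lemma gdist_edge_le:
  assumes "{v, u} \<in> edges X"
  shows "gdist X v u \<le> 1"
proof -
  have "edge_path X v [(v, u)] u"
    using assms edge_vertices[OF assms] by (simp add: awalk_Cons_iff awalk_Nil_iff)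
  from gdist_le[OF this] show ?thesis by (simp add: one_ereal_def)
qed

lemma edge_path_chain:
  assumes "h 0 \<in> vertices X" "\<And>i. i < n \<Longrightarrow> {h i, h (Suc i)} \<in> edges X"
  shows "edge_path X (h 0) (chain h n) (h n)"
  using assms
proof (induction n arbitrary: h)
  case 0
  then show ?case by (simp add: chain_def awalk_Nil_iff)
next
  case (Suc n)
  have e: "{h 0, h 1} \<in> edges X" using Suc.prems(2)[of 0] by simp
  have "edge_path X (h (Suc 0)) (chain (\<lambda>i. h (Suc i)) n) (h (Suc n))"
    using Suc.IH[of "\<lambda>i. h (Suc i)"] Suc.prems(2) edge_vertices(2)[OF e] by simp
  with e show ?case by (simp add: chain_Suc awalk_Cons_iff)
qed

lemma calibrated_geodesic:
  assumes "lipschitz X f" "calibrated X f h n" "h 0 \<in> vertices X"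
  shows "geodesic X (h 0) (chain h n) (h n)" "gdist X (h 0) (h n) = ereal (real n)"
proof -
  have p: "edge_path X (h 0) (chain h n) (h n)"
    using assms by (intro edge_path_chain) (auto simp: calibrated_def)
  have "real_of_int (f (h 0) - f (h n)) = real n"
    using calibrated_drop[OF assms(2)] by simp
  with lipschitz_gdist[OF assms(1), of "h 0" "h n"] gdist_le[OF p]
  show d: "gdist X (h 0) (h n) = ereal (real n)" by simp
  with p show "geodesic X (h 0) (chain h n) (h n)" by (simp add: geodesic_def)
qed

text \<open>A tail of a calibrated path is calibrated, hence itself geodesic.\<close>

lemma calibrated_tail:
  assumes "lipschitz X f" "calibrated X f h n" "i < n"
  shows "gdist X (h i) (h n) = ereal (real (n - i))"
    and "(h i, h (Suc i)) \<in> first_edges X (h i) (h n)"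
proof -
  have "h i \<in> vertices X"
    using assms edge_vertices by (auto simp: calibrated_def)
  then have *: "geodesic X (h i) (chain (\<lambda>j. h (i + j)) (n - i)) (h n)"
      "gdist X (h i) (h n) = ereal (real (n - i))"
    using calibrated_geodesic[OF assms(1) calibrated_shift[OF assms(2), of i]] assms(3) by simp_all
  then show "gdist X (h i) (h n) = ereal (real (n - i))" by simp
  obtain k where "n - i = Suc k" using assms(3) by (metis Suc_diff_Suc)
  then have "hd (chain (\<lambda>j. h (i + j)) (n - i)) = (h i, h (Suc i))"
    by (simp add: chain_Suc)
  with * show "(h i, h (Suc i)) \<in> first_edges X (h i) (h n)"
    unfolding first_edges_def by (metis (mono_tags, lifting) CollectI)
qed

lemma first_edge_lipschitz:
  assumes "lipschitz X f" "gdist X v u = ereal (real n)" "0 < n" "e \<in> first_edges X v u"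
  obtains y where "e = (v, y)" "{v, y} \<in> edges X" "f y + 1 \<le> f u + int n"
proof -
  from assms(4) obtain p where p: "geodesic X v p u" and e: "e = hd p"
    by (auto simp: first_edges_def)
  from p assms(2) have l: "length p = n" by (simp add: geodesic_def)
  \<comment> \<open>Since \<open>0 < n\<close>, the path is not empty and \<open>hd p\<close> is a
    genuine edge.\<close>
  with assms(3) e obtain q where q: "p = e # q" by (cases p) auto
  with p have "{fst e, snd e} \<in> edges X" "fst e = v" "edge_path X (snd e) q u"
    by (cases e; simp add: geodesic_def awalk_Cons_iff)+
  with lipschitz_path[OF assms(1), of "snd e" q u] q l that[of "snd e"] show thesis
    by (cases e) auto
qed

text \<open>The drop of \<open>f\<close> still to come equals the number of steps left, so no
  geodesic can waste its first step. This reduces finding first edges to inspecting the neighbours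
  with smaller \<open>f\<close>.\<close>

lemma calibrated_first_edge:
  assumes "lipschitz X f" "calibrated X f h n" "i < n" "e \<in> first_edges X (h i) (h n)"
  obtains y where "e = (h i, y)" "{h i, y} \<in> edges X" "f y < f (h i)"
proof -
  have "f (h i) = f (h n) + int (n - i)"
    using calibrated_drop[OF calibrated_shift[OF assms(2), of i]] assms(3) by simp
  moreover from assms(3) have "0 < n - i" by simp
  then obtain y where "e = (h i, y)" "{h i, y} \<in> edges X" "f y + 1 \<le> f (h n) + int (n - i)"
    using first_edge_lipschitz[OF assms(1) calibrated_tail(1)[OF assms(1-3)] _ assms(4)] by metis
  ultimately show thesis using that by simp
qed

text \<open>The square and triangle rules of \<open>next_choke\<close> only bound the first edges
  from above; their geodesics along both sides supply the converse inclusion.\<close>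

lemma geodesic_along_first_edge:
  assumes "geodesic_along X (v # x # vs) v u"
  shows "(v, x) \<in> first_edges X v u"
proof -
  from assms obtain p where p: "geodesic X v p u" and pre: "prefix (v # x # vs) (path_verts X v p)"
    by (auto simp: geodesic_along_def)
  from pre obtain e q where q: "p = e # q"
    by (cases p) (auto simp: pre_digraph.awalk_verts.simps)
  have "hd (path_verts X (snd e) q) = snd e"
    using p q by (intro awhd_if_cas) (auto simp: geodesic_def awalk_def)
  with pre q have "e = (v, x)"
    by (cases e; cases "path_verts X (snd e) q") (auto simp: pre_digraph.awalk_verts.simps)
  with p q show ?thesis unfolding first_edges_def by force
qed

section \<open>Choke points determined by first edges\<close>

text \<open>The square and triangle rules would each produce two different first edges.\<close>

lemma next_choke_unique:
  assumes "next_choke X v u v'" "first_edges X v u \<subseteq> {(v, y)}"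
  shows "v' = y"
  using assms(1)
proof cases
  case same_edge
  with assms(2) show ?thesis by simp
next
  case (square x z)
  with assms(2) geodesic_along_first_edge[of v x "[v']" u] geodesic_along_first_edge[of v z "[v']" u]
  show ?thesis by auto
next
  case (triangle xs ys)
  then obtain a as b bs where "xs = a # as" "ys = b # bs" "a \<noteq> b"
    by (cases xs; cases ys) (auto simp: square_row_def)
  with triangle assms(2) geodesic_along_first_edge[of v a "as @ [v']" u]
    geodesic_along_first_edge[of v b "bs @ [v']" u]
  show ?thesis by auto
qed

text \<open>As no square contains \<open>x\<close> and \<open>y\<close>, the square rule is excluded
  and the row of squares is empty. The second triangle then shares the edge \<open>{x, y}\<close>
  with the first, and its remaining vertex is \<open>z\<close>.\<close>

lemma next_choke_two_triangles:
  assumes "next_choke X v u v'" "first_edges X v u = {(v, x), (v, y)}" "x \<noteq> y"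
    and no_square: "\<And>s. s \<in> squares X \<Longrightarrow> \<not> {x, y} \<subseteq> s"
    and two: "\<And>t. t \<in> triangles X \<Longrightarrow> {x, y} \<subseteq> t \<Longrightarrow> t = {v, x, y} \<or> t = {x, y, z}"
  shows "v' = z"
  using assms(1)
proof cases
  case same_edge
  with assms(2,3) show ?thesis by auto
next
  case (square a b)
  then have "{a, b} = {x, y}"
    using assms(2) geodesic_along_first_edge[of v a "[v']" u]
      geodesic_along_first_edge[of v b "[v']" u] by auto
  with square no_square show ?thesis by blast
next
  case (triangle xs ys)
  then obtain a as b bs where xy: "xs = a # as" "ys = b # bs" "a \<noteq> b"
    by (cases xs; cases ys) (auto simp: square_row_def)
  with triangle assms(2) geodesic_along_first_edge[of v a "as @ [v']" u]
    geodesic_along_first_edge[of v b "bs @ [v']" u]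
  have ab: "{a, b} = {x, y}" by auto
  have "as = []"
  proof (rule ccontr)
    assume "as \<noteq> []"
    then have "{a, b, xs ! 1, ys ! 1} \<in> squares X"
      using triangle(1) xy by (auto simp: square_row_def dest!: spec[of _ 0])
    with no_square ab show False by blast
  qed
  moreover have "length as = length bs" using triangle(1) xy by (simp add: square_row_def)
  ultimately have "{a, b, v'} \<in> triangles X" "{v, a, b} \<noteq> {a, b, v'}" "v' \<notin> {a, b}"
    using triangle xy by auto
  with two[of "{a, b, v'}"] ab show ?thesis by auto
qed

lemma calibrated_next_choke:
  assumes "lipschitz X f" "calibrated X f h n" "i < n" "next_choke X (h i) (h n) v'"
    and "\<And>z. {h i, z} \<in> edges X \<Longrightarrow> f z < f (h i) \<Longrightarrow> z = h (Suc i)"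
  shows "v' = h (Suc i)"
proof (rule next_choke_unique[OF assms(4)], rule subsetI)
  fix e assume "e \<in> first_edges X (h i) (h n)"
  with assms(5) show "e \<in> {(h i, h (Suc i))}"
    by (elim calibrated_first_edge[OF assms(1-3)]) simp
qed

lemma calibrated_two_first_edges:
  assumes "lipschitz X f" "calibrated X f h n" "Suc i < n"
    and "{h i, y} \<in> edges X" "{y, h (Suc (Suc i))} \<in> edges X" "f y = f (h (Suc i))"
    and "\<And>z. {h i, z} \<in> edges X \<Longrightarrow> f z < f (h i) \<Longrightarrow> z = h (Suc i) \<or> z = y"
  shows "first_edges X (h i) (h n) = {(h i, h (Suc i)), (h i, y)}"
proof (intro equalityI subsetI)
  fix e assume "e \<in> first_edges X (h i) (h n)"
  with assms(3,7) show "e \<in> {(h i, h (Suc i)), (h i, y)}"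
    by (elim calibrated_first_edge[OF assms(1,2) Suc_lessD[OF assms(3)]]) auto
next
  \<comment> \<open>Rerouting through \<open>y\<close> keeps the calibration, and
    \<open>Suc i < n\<close> keeps the endpoint; hence both edges start geodesics.\<close>
  have "calibrated X f (h(Suc i := y)) n"
    using assms(2-6) by (auto simp: calibrated_def)
  from calibrated_tail(2)[OF assms(1) this, of i] calibrated_tail(2)[OF assms(1,2), of i] assms(3)
  have "(h i, y) \<in> first_edges X (h i) (h n)" "(h i, h (Suc i)) \<in> first_edges X (h i) (h n)"
    by simp_all
  then show "e \<in> first_edges X (h i) (h n)" if "e \<in> {(h i, h (Suc i)), (h i, y)}" for e
    using that by auto
qed

text \<open>\<open>gersten_short\<close> asks only that the choke points lie on the path, so it
  suffices to enclose them in a set closed under \<open>next_choke\<close>.\<close>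

lemma choke_points_subset:
  assumes "v \<in> S" "\<And>x y. x \<in> S \<Longrightarrow> x \<noteq> u \<Longrightarrow> next_choke X x u y \<Longrightarrow> y \<in> S"
  shows "choke_points X v u \<subseteq> S"
proof
  fix w assume "w \<in> choke_points X v u"
  then have "choke_point X u v w" by (simp add: choke_points_def)
  then show "w \<in> S" using assms(1) by induction (auto intro: assms(2))
qed

lemma calibrated_gersten_short:
  assumes "lipschitz X f" "calibrated X f h n" "h 0 \<in> vertices X" "h 0 \<in> S" "S \<subseteq> h ` {..n}"
    and "\<And>x y. x \<in> S \<Longrightarrow> x \<noteq> h n \<Longrightarrow> next_choke X x (h n) y \<Longrightarrow> y \<in> S"
  shows "gersten_short X (h 0) (chain h n) (h n)"
proof -
  have "choke_points X (h 0) (h n) \<subseteq> S" using assms(4,6) by (rule choke_points_subset)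
  also have "\<dots> \<subseteq> set (path_verts X (h 0) (chain h n))"
    using assms(5) by (simp add: path_verts_chain atLeast0LessThan lessThan_Suc_atMost del: upt_Suc)
  finally show ?thesis
    using calibrated_geodesic(1)[OF assms(1-3)] by (simp add: gersten_short_def)
qed

end

section \<open>Edges of \<open>flat_F\<close> and functions linear on each sector\<close>

lemma edges_flat_F_cases:
  assumes "e \<in> edges flat_F"
  obtains (centre) k where "k < 6" "e = {Center, Pt k 0 0}"
  | (axis1) k a b where "k < 6" "e = {Pt k a b, Pt k (Suc a) b}"
  | (axis2) k a b where "k < 6" "e = {Pt k a b, Pt k a (Suc b)}"
  | (oblique) k a b where "k < 6" "e = {Pt k (Suc a) b, Pt k a (Suc b)}"
  | (rung) k b where "k < 6" "e = {Pt k 0 b, Pt (next_sector k) b 0}"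
  using assms unfolding flat_F_def ts_complex.simps Un_iff mem_Collect_eq Suc_eq_plus1
  by (elim disjE exE conjE) (rule that; assumption)+

text \<open>Turns every descent question into a finite check: six lattice directions, with a rung
  where the sector ends. \<open>(k + 5) mod 6\<close> is the preceding sector.\<close>

lemma sector_edge:
  assumes "{Pt k a b, y} \<in> edges flat_F"
  shows "y = Pt k (Suc a) b \<or> y = Pt k a (Suc b) \<or>
    (\<exists>a'. a = Suc a' \<and> (y = Pt k a' b \<or> y = Pt k a' (Suc b))) \<or>
    (\<exists>b'. b = Suc b' \<and> (y = Pt k a b' \<or> y = Pt k (Suc a) b')) \<or>
    a = 0 \<and> y = Pt (next_sector k) b 0 \<or> b = 0 \<and> y = Pt ((k + 5) mod 6) 0 a \<or>
    a = 0 \<and> b = 0 \<and> y = Center"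
  using assms
proof (cases rule: edges_flat_F_cases)
  case (rung l c)
  from rung(2) consider "k = l" "a = 0" "y = Pt (next_sector l) b 0"
    | "k = next_sector l" "b = 0" "y = Pt l 0 a"
    unfolding doubleton_eq_iff by blast
  then show ?thesis
  proof cases
    case 2
    from 2(1) rung(1) have "(k + 5) mod 6 = l" by presburger
    with 2(2,3) show ?thesis by simp
  qed simp
next
  case (centre l) then show ?thesis by (simp add: doubleton_eq_iff)
next
  case (axis1 l c d) then show ?thesis by (simp add: doubleton_eq_iff) metis
next
  case (axis2 l c d) then show ?thesis by (simp add: doubleton_eq_iff) metis
next
  case (oblique l c d) then show ?thesis by (simp add: doubleton_eq_iff) metis
qed
text \<open>
  \<open>L ! k\<close> is the value of the linear functional at \<open>z\<^sup>k\<close>, \<open>g ! k\<close> the correction on sector \<open>k\<close>, and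
  \<open>s\<close> the value at the centre of the hexagon.
\<close>

fun pot :: "int list \<Rightarrow> int list \<Rightarrow> int \<Rightarrow> F_vertex \<Rightarrow> int" where
  "pot L g s Center = s"
| "pot L g s (Pt k a b) = int a * L ! k + int b * L ! next_sector k + g ! k"

text \<open>The bounds on \<open>L\<close> control the axis edges and the oblique edges. Along a
  rung the linear parts cancel, leaving a difference of corrections, and the last bound controls the
  spokes of the hexagon.\<close>

lemma lipschitz_pot:
  assumes "\<forall>k \<in> {0..<6}. \<bar>L ! k\<bar> \<le> 1 \<and> \<bar>L ! next_sector k - L ! k\<bar> \<le> 1 \<and>
    \<bar>g ! next_sector k - g ! k\<bar> \<le> 1 \<and> \<bar>g ! k - s\<bar> \<le> 1"
  shows "lipschitz flat_F (pot L g s)"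
proof -
  have *: "\<bar>L ! k\<bar> \<le> 1 \<and> \<bar>L ! next_sector k - L ! k\<bar> \<le> 1 \<and> \<bar>L ! next_sector k\<bar> \<le> 1 \<and>
    \<bar>g ! next_sector k - g ! k\<bar> \<le> 1 \<and> \<bar>g ! k - s\<bar> \<le> 1" if "k < 6" for k
    using assms that by simp
  show ?thesis
    unfolding lipschitz_def
  proof (intro allI impI)
    fix x y assume "{x, y} \<in> edges flat_F"
    then show "pot L g s x \<le> pot L g s y + 1"
    proof (cases rule: edges_flat_F_cases)
      case (centre k)
      with *[of k] show ?thesis by (auto simp: doubleton_eq_iff)
    next
      case (axis1 k a b)
      with *[of k] show ?thesis by (auto simp: doubleton_eq_iff algebra_simps)
    next
      case (axis2 k a b)
      with *[of k] show ?thesis by (auto simp: doubleton_eq_iff algebra_simps)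
    next
      case (oblique k a b)
      with *[of k] show ?thesis by (auto simp: doubleton_eq_iff algebra_simps)
    next
      case (rung k b)
      with *[of k] show ?thesis by (auto simp: doubleton_eq_iff)
    qed
  qed
qed

section \<open>The three potentials\<close>

lemma atLeast0LessThan6: "{0..<6} = {0, 1, 2, 3, 4, 5 :: nat}"
  by auto

text \<open>The functional falls by one along both \<open>-1\<close> and \<open>-z\<close>. It
  vanishes on the ray \<open>z^2\<close>, so the correction, which drops from 1 to 0 between sectors
  1 and 2, makes crossing that strip a descent at every height.\<close>

definition pot_around :: "F_vertex \<Rightarrow> int" where
  "pot_around = pot [1, 1, 0, -1, -1, 0] [1, 1, 0, 0, 0, 0] 0"

text \<open>
  The first functional takes the same value at \<open>z\<^sup>3\<close> and \<open>z\<^sup>4\<close>, so it does not single out the ray \<open>z\<^sup>3\<close> in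
  sector 3; the second one does.
\<close>

definition pot_centre :: "F_vertex \<Rightarrow> int" where
  "pot_centre = (\<lambda>x. max (pot [1, 1, 0, -1, -1, 0] [2, 2, 1, 0, 1, 2] 1 x)
     (pot [1, 0, -1, -1, 0, 1] [0, 0, 0, 0, 0, 0] 0 x))"

text \<open>The functional is the coefficient of \<open>z\<close> in the basis \<open>1, z\<close>;
  it separates the two paths at the end.\<close>

definition pot_height :: "F_vertex \<Rightarrow> int" where
  "pot_height = pot [0, 1, 1, 0, -1, -1] [0, 0, 0, 0, 0, 0] 0"

lemma lipschitz_pots:
  "lipschitz flat_F pot_around" "lipschitz flat_F pot_centre" "lipschitz flat_F pot_height"
proof -
  show "lipschitz flat_F pot_around"
    unfolding pot_around_def by (rule lipschitz_pot) (simp add: atLeast0LessThan6)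
  show "lipschitz flat_F pot_centre"
    unfolding pot_centre_def
    by (rule lipschitz_max; rule lipschitz_pot) (simp_all add: atLeast0LessThan6)
  show "lipschitz flat_F pot_height"
    unfolding pot_height_def by (rule lipschitz_pot) (simp add: atLeast0LessThan6)
qed

section \<open>The two paths and their calibrations\<close>

text \<open>In both sectors the steps alternate between \<open>-z\<close> and \<open>-1\<close>, so
  two of them give \<open>-1 - z\<close>. The step from index \<open>2 * j\<close> is the
  rung.\<close>

definition around :: "nat \<Rightarrow> nat \<Rightarrow> F_vertex" where
  "around j n = (if n \<le> 2 * j then Pt 1 (2 * j - n) (n div 2)
     else Pt 2 ((4 * j + 1 - n) div 2) (n - 2 * j - 1))"

definition through :: "nat \<Rightarrow> nat \<Rightarrow> F_vertex" where
  "through m n = (if n \<le> m then Pt 0 0 (m - n) else if n = m + 1 then Center else Pt 3 (n - m - 2) 0)"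

lemma edge_sector:
  assumes "k < 6"
  shows "{Pt k (Suc a) b, Pt k a b} \<in> edges flat_F"
    "{Pt k (Suc a) b, Pt k a (Suc b)} \<in> edges flat_F"
    "{Pt k a b, Pt k (Suc a) b} \<in> edges flat_F"
    "{Pt k a b, Pt k a (Suc b)} \<in> edges flat_F"
    "{Pt k a (Suc b), Pt k a b} \<in> edges flat_F"
    "{Pt k 0 b, Pt (next_sector k) b 0} \<in> edges flat_F"
  using assms unfolding flat_F_def by (auto simp: doubleton_eq_iff)

lemma calibrated_around: "calibrated flat_F pot_around (around j) (4 * j + 1)"
  unfolding calibrated_def
proof (intro allI impI)
  fix i assume "i < 4 * j + 1"
  \<comment> \<open>The parity of the step selects its direction; writing
    \<open>j = c + Suc d\<close> below removes the truncated subtractions.\<close>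
  then have "(\<exists>c. i = 2 * c \<and> c < j) \<or> (\<exists>c. i = 2 * c + 1 \<and> c < j) \<or> i = 2 * j \<or>
      (\<exists>c. i = 2 * j + 1 + 2 * c \<and> c < j) \<or> (\<exists>c. i = 2 * j + 2 + 2 * c \<and> c < j)"
    by presburger
  then consider c where "i = 2 * c" "c < j" | c where "i = 2 * c + 1" "c < j" | "i = 2 * j"
    | c where "i = 2 * j + 1 + 2 * c" "c < j" | c where "i = 2 * j + 2 + 2 * c" "c < j"
    by blast
  then show "{around j i, around j (Suc i)} \<in> edges flat_F \<and>
      pot_around (around j i) = pot_around (around j (Suc i)) + 1"
  proof cases
    case (1 c)
    then obtain d where "j = c + Suc d" by (metis less_iff_Suc_add add_Suc_right)
    with 1 show ?thesis by (simp add: around_def pot_around_def edge_sector)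
  next
    case (2 c)
    then obtain d where "j = c + Suc d" by (metis less_iff_Suc_add add_Suc_right)
    with 2 show ?thesis by (simp add: around_def pot_around_def edge_sector)
  next
    case 3
    have "{Pt 1 0 j, Pt 2 j 0} \<in> edges flat_F"
      using edge_sector(6)[of 1 j] by (simp add: numeral_2_eq_2)
    with 3 show ?thesis by (simp add: around_def pot_around_def)
  next
    case (4 c)
    then obtain d where "j = c + Suc d" by (metis less_iff_Suc_add add_Suc_right)
    with 4 show ?thesis by (simp add: around_def pot_around_def edge_sector)
  next
    case (5 c)
    then obtain d where "j = c + Suc d" by (metis less_iff_Suc_add add_Suc_right)
    with 5 show ?thesis by (simp add: around_def pot_around_def edge_sector)
  qed
qed

lemma through_cases:
  fixes i m :: nat
  obtains c where "m = i + Suc c" | "i = m" | "i = Suc m" | c where "i = Suc (Suc m) + c"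
proof -
  have "m = i + Suc (m - Suc i) \<or> i = m \<or> i = Suc m \<or> i = Suc (Suc m) + (i - Suc (Suc m))"
    by arith
  then show thesis using that by blast
qed

text \<open>On this path the first functional attains the maximum. Its corrections
  \<open>2, 2, 1, 0, 1, 2\<close>, with 1 at the centre, are the distances to
  \<open>Pt 3 0 0\<close> inside the hexagon, so crossing through \<open>Center\<close> descends
  twice.\<close>

lemma calibrated_through: "calibrated flat_F pot_centre (through m) (2 * m + 2)"
  unfolding calibrated_def
proof (intro allI impI)
  fix i assume "i < 2 * m + 2"
  consider c where "m = i + Suc c" | "i = m" | "i = Suc m" | c where "i = Suc (Suc m) + c"
    by (rule through_cases)
  then show "{through m i, through m (Suc i)} \<in> edges flat_F \<and>
      pot_centre (through m i) = pot_centre (through m (Suc i)) + 1"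
  proof cases
    case (1 c)
    then show ?thesis by (simp add: through_def pot_centre_def edge_sector)
  next
    case 2
    then show ?thesis by (auto simp: through_def pot_centre_def flat_F_def)
  next
    case 3
    then show ?thesis by (auto simp: through_def pot_centre_def flat_F_def)
  next
    case (4 c)
    then show ?thesis by (simp add: through_def pot_centre_def edge_sector)
  qed
qed

section \<open>Descending neighbours along the two paths\<close>

lemma descent_around_1:
  assumes "{Pt 1 (Suc a) b, y} \<in> edges flat_F" "pot_around y < pot_around (Pt 1 (Suc a) b)"
  shows "y = Pt 1 a b \<or> y = Pt 1 a (Suc b)"
  using sector_edge[OF assms(1)] assms(2) by (auto simp: pot_around_def)

text \<open>At height 0 \<open>Center\<close> would be a second descending neighbour, hence
  \<open>Suc b\<close>.\<close>

lemma descent_around_rung: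
  assumes "{Pt 1 0 (Suc b), y} \<in> edges flat_F" "pot_around y < pot_around (Pt 1 0 (Suc b))"
  shows "y = Pt 2 (Suc b) 0"
  using sector_edge[OF assms(1)] assms(2) by (auto simp: pot_around_def)

lemma descent_around_2:
  assumes "{Pt 2 (Suc a) b, y} \<in> edges flat_F" "pot_around y < pot_around (Pt 2 (Suc a) b)"
  shows "y = Pt 2 (Suc a) (Suc b) \<or> y = Pt 2 a (Suc b)"
  using sector_edge[OF assms(1)] assms(2) by (auto simp: pot_around_def)

lemma descent_through_0:
  assumes "{Pt 0 0 (Suc c), y} \<in> edges flat_F" "pot_centre y < pot_centre (Pt 0 0 (Suc c))"
  shows "y = Pt 0 0 c"
  using sector_edge[OF assms(1)] assms(2) by (auto simp: pot_centre_def)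

lemma descent_through_corner:
  assumes "{Pt 0 0 0, y} \<in> edges flat_F" "pot_centre y < pot_centre (Pt 0 0 0)"
  shows "y = Center"
  using sector_edge[OF assms(1)] assms(2) by (auto simp: pot_centre_def)

lemma descent_through_Center:
  assumes "{Center, y} \<in> edges flat_F" "pot_centre y < pot_centre Center"
  shows "y = Pt 3 0 0"
proof -
  from assms(1) obtain k where "k \<in> {0..<6}" "y = Pt k 0 0"
    by (cases rule: edges_flat_F_cases) (auto simp: doubleton_eq_iff)
  with assms(2) show ?thesis unfolding atLeast0LessThan6 by (auto simp: pot_centre_def)
qed

text \<open>At \<open>Pt 3 c 1\<close> the first functional has fallen, but the second has kept the
  value \<open>- int c\<close>.\<close>

lemma descent_through_3:
  assumes "{Pt 3 c 0, y} \<in> edges flat_F" "pot_centre y < pot_centre (Pt 3 c 0)"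
  shows "y = Pt 3 (Suc c) 0"
  using sector_edge[OF assms(1)] assms(2) by (auto simp: pot_centre_def)

section \<open>Squares and triangles at an edge inside a sector\<close>

text \<open>A square meets a sector in one side only, lying on the boundary of the sector, where one
  of the two coordinates is constantly 0.\<close>

lemma no_square_inside_sector:
  assumes "s \<in> squares flat_F"
  shows "\<not> {Pt k (Suc a) b, Pt k c (Suc d)} \<subseteq> s"
proof -
  have "k \<noteq> next_sector k" if "k < 6" for k
    using that by presburger
  with assms show ?thesis by (auto simp: flat_F_def)
qed

lemma triangles_flat_F_cases:
  assumes "t \<in> triangles flat_F"
  obtains (centre) k where "k < 6" "t = {Center, Pt k 0 0, Pt (next_sector k) 0 0}"
  | (up) k a b where "k < 6" "t = {Pt k a b, Pt k (Suc a) b, Pt k a (Suc b)}"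
  | (down) k a b where "k < 6" "t = {Pt k (Suc a) b, Pt k a (Suc b), Pt k (Suc a) (Suc b)}"
  using assms unfolding flat_F_def ts_complex.simps Un_iff mem_Collect_eq Suc_eq_plus1
  by (elim disjE exE conjE) (rule that; assumption)+

text \<open>Provides the two triangles for \<open>next_choke_two_triangles\<close>: the first part
  serves sector 1, the second sector 2. The successors keep the edge off the side of the sector
  parallel to it.\<close>

lemma triangles_across_edge:
  assumes "t \<in> triangles flat_F"
  shows "{Pt k (Suc a) b, Pt k (Suc a) (Suc b)} \<subseteq> t \<Longrightarrow>
      t = {Pt k (Suc (Suc a)) b, Pt k (Suc a) b, Pt k (Suc a) (Suc b)} \<or>
      t = {Pt k (Suc a) b, Pt k (Suc a) (Suc b), Pt k a (Suc b)}"
    and "{Pt k (Suc a) (Suc b), Pt k a (Suc b)} \<subseteq> t \<Longrightarrow>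
      t = {Pt k (Suc a) b, Pt k (Suc a) (Suc b), Pt k a (Suc b)} \<or>
      t = {Pt k (Suc a) (Suc b), Pt k a (Suc b), Pt k a (Suc (Suc b))}"
proof -
  assume "{Pt k (Suc a) b, Pt k (Suc a) (Suc b)} \<subseteq> t"
  with assms show "t = {Pt k (Suc (Suc a)) b, Pt k (Suc a) b, Pt k (Suc a) (Suc b)} \<or>
      t = {Pt k (Suc a) b, Pt k (Suc a) (Suc b), Pt k a (Suc b)}"
    by (cases rule: triangles_flat_F_cases) (simp_all, (elim disjE conjE; simp; blast)+)
next
  assume "{Pt k (Suc a) (Suc b), Pt k a (Suc b)} \<subseteq> t"
  with assms show "t = {Pt k (Suc a) b, Pt k (Suc a) (Suc b), Pt k a (Suc b)} \<or>
      t = {Pt k (Suc a) (Suc b), Pt k a (Suc b), Pt k a (Suc (Suc b))}"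
    by (cases rule: triangles_flat_F_cases) (simp_all, (elim disjE conjE; simp; blast)+)
qed

section \<open>Both paths are Gersten-Short geodesics\<close>

lemma gersten_short_around:
  assumes pos: "0 < j"
  shows "gersten_short flat_F (Pt 1 (2 * j) 0) (chain (around j) (4 * j + 1)) (Pt 2 0 (2 * j))"
proof -
  let ?n = "4 * j + 1"
  \<comment> \<open>These are every second vertex of \<open>around j\<close>: the even indices
    before the rung and the odd ones after it. Successive elements differ by \<open>-1 - z\<close>,
    except across the rung.\<close>
  let ?S = "{Pt 1 (2 * a) b | a b. a + b = j} \<union> {Pt 2 a (2 * b) | a b. a + b = j}"
  note cal = lipschitz_pots(1) calibrated_around[of j]
  note two = next_choke_two_triangles[OF wf_digraph_skeleton_flat_F]
  note ends = calibrated_two_first_edges[OF wf_digraph_skeleton_flat_F cal]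
  have h0: "around j 0 = Pt 1 (2 * j) 0" and hn: "around j ?n = Pt 2 0 (2 * j)"
    by (simp_all add: around_def)
  have "gersten_short flat_F (around j 0) (chain (around j) ?n) (around j ?n)"
  proof (rule calibrated_gersten_short[OF wf_digraph_skeleton_flat_F cal, where S = ?S])
    show "around j 0 \<in> vertices flat_F" by (simp add: h0 flat_F_def)
    show "around j 0 \<in> ?S" by (auto simp: h0)
    have "Pt 1 (2 * a) b \<in> around j ` {..?n}" if "a + b = j" for a b
      by (rule image_eqI[where x = "2 * b"]) (use that in \<open>auto simp: around_def\<close>)
    moreover have "Pt 2 a (2 * b) \<in> around j ` {..?n}" if "a + b = j" for a b
      by (rule image_eqI[where x = "2 * j + 1 + 2 * b"]) (use that in \<open>auto simp: around_def\<close>)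
    ultimately show "?S \<subseteq> around j ` {..?n}" by blast
  next
    fix x y assume S: "x \<in> ?S" and ne: "x \<noteq> around j ?n" and nc: "next_choke flat_F x (around j ?n) y"
    consider a b where "x = Pt 1 (2 * Suc a) b" "Suc a + b = j"
      | "x = Pt 1 0 j" | a b where "x = Pt 2 (Suc a) (2 * b)" "Suc a + b = j"
    proof -
      from S consider a b where "x = Pt 1 (2 * a) b" "a + b = j"
        | a b where "x = Pt 2 a (2 * b)" "a + b = j"
        by blast
      then show thesis
      proof cases
        case (1 a b)
        then show thesis using that(1,2) by (cases a) auto
      next
        case (2 a b)
        then show thesis using that(3) ne hn by (cases a) auto
      qed
    qed
    then show "y \<in> ?S"
    proof cases
      case (1 a b)
      have h: "around j (2 * b) = x" "around j (Suc (2 * b)) = Pt 1 (Suc (2 * a)) b"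
        "around j (Suc (Suc (2 * b))) = Pt 1 (2 * a) (Suc b)"
        using 1 by (auto simp: around_def)
      have "first_edges flat_F x (around j ?n) =
          {(x, Pt 1 (Suc (2 * a)) b), (x, Pt 1 (Suc (2 * a)) (Suc b))}"
        using ends[of "2 * b" "Pt 1 (Suc (2 * a)) (Suc b)"]
          descent_around_1[of "Suc (2 * a)" b] 1 unfolding h
        by (auto simp: edge_sector pot_around_def)
      then have "y = Pt 1 (2 * a) (Suc b)"
      proof (rule two[OF nc _ _ no_square_inside_sector])
        show "Pt 1 (Suc (2 * a)) b \<noteq> Pt 1 (Suc (2 * a)) (Suc b)" by simp
      qed (use triangles_across_edge(1)[of _ 1 "2 * a" b] 1 in simp_all)
      with 1 show ?thesis by auto
    next
      case 2
      have "z = around j (Suc (2 * j))"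
        if "{around j (2 * j), z} \<in> edges flat_F" "pot_around z < pot_around (around j (2 * j))" for z
        using that descent_around_rung[of "j - 1" z] pos by (simp add: around_def)
      from calibrated_next_choke[OF wf_digraph_skeleton_flat_F cal _ _ this, of y] nc 2
      have "y = Pt 2 j 0" by (simp add: around_def)
      then show ?thesis by auto
    next
      case (3 a b)
      let ?i = "2 * j + 1 + 2 * b"
      have h: "around j ?i = x" "around j (Suc ?i) = Pt 2 a (Suc (2 * b))"
        "around j (Suc (Suc ?i)) = Pt 2 a (Suc (Suc (2 * b)))"
        using 3 by (auto simp: around_def)
      have "first_edges flat_F x (around j ?n) =
          {(x, Pt 2 a (Suc (2 * b))), (x, Pt 2 (Suc a) (Suc (2 * b)))}"
      proof (rule ends[of ?i "Pt 2 (Suc a) (Suc (2 * b))", unfolded h])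
        show "Suc ?i < ?n" using 3 by simp
        show "{x, Pt 2 (Suc a) (Suc (2 * b))} \<in> edges flat_F" using 3 by (simp add: edge_sector)
        show "{Pt 2 (Suc a) (Suc (2 * b)), Pt 2 a (Suc (Suc (2 * b)))} \<in> edges flat_F"
          by (simp add: edge_sector)
        show "pot_around (Pt 2 (Suc a) (Suc (2 * b))) = pot_around (Pt 2 a (Suc (2 * b)))"
          by (simp add: pot_around_def)
      next
        fix z assume "{x, z} \<in> edges flat_F" "pot_around z < pot_around x"
        with 3 descent_around_2[of a "2 * b" z]
        show "z = Pt 2 a (Suc (2 * b)) \<or> z = Pt 2 (Suc a) (Suc (2 * b))" by blast
      qed
      \<comment> \<open>Swapped so that the vertex with positive first coordinate comes first, as in
        \<open>no_square_inside_sector\<close>.\<close>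
      then have "first_edges flat_F x (around j ?n) =
          {(x, Pt 2 (Suc a) (Suc (2 * b))), (x, Pt 2 a (Suc (2 * b)))}"
        by (simp add: insert_commute)
      then have "y = Pt 2 a (2 * Suc b)"
      proof (rule two[OF nc _ _ no_square_inside_sector])
        show "Pt 2 (Suc a) (Suc (2 * b)) \<noteq> Pt 2 a (Suc (2 * b))" by simp
      qed (use triangles_across_edge(2)[of _ 2 a "2 * b"] 3 in simp_all)
      with 3 have "y = Pt 2 a (2 * Suc b) \<and> a + Suc b = j" by simp
      then show ?thesis by blast
    qed
  qed
  then show ?thesis unfolding h0 hn .
qed

text \<open>Every vertex before the last has a single descending neighbour, so the vertex set of the
  path is itself closed under \<open>next_choke\<close>.\<close>

lemma gersten_short_through:
  "gersten_short flat_F (Pt 0 0 m) (chain (through m) (2 * m + 2)) (Pt 3 m 0)"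
proof -
  let ?n = "2 * m + 2"
  note cal = wf_digraph_skeleton_flat_F lipschitz_pots(2) calibrated_through[of m]
  have "gersten_short flat_F (through m 0) (chain (through m) ?n) (through m ?n)"
  proof (rule calibrated_gersten_short[OF cal, where S = "through m ` {..?n}"])
    show "through m 0 \<in> vertices flat_F" by (simp add: through_def flat_F_def)
  next
    fix x y assume "x \<in> through m ` {..?n}" "x \<noteq> through m ?n"
      and nc: "next_choke flat_F x (through m ?n) y"
    then obtain i where i: "x = through m i" "i < ?n" by (auto simp: order_le_less)
    have "z = through m (Suc i)"
      if z: "{through m i, z} \<in> edges flat_F" "pot_centre z < pot_centre (through m i)" for z
    proof -
      consider c where "m = i + Suc c" | "i = m" | "i = Suc m" | c where "i = Suc (Suc m) + c"
        by (rule through_cases)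
      then show ?thesis
      proof cases
        case (1 c)
        with z descent_through_0[of c z] show ?thesis by (simp add: through_def)
      next
        case 2
        with z descent_through_corner[of z] show ?thesis by (simp add: through_def)
      next
        case 3
        with z descent_through_Center[of z] show ?thesis by (simp add: through_def)
      next
        case (4 c)
        with z descent_through_3[of c z] show ?thesis by (simp add: through_def)
      qed
    qed
    then have "y = through m (Suc i)"
      using nc unfolding i(1) by (rule calibrated_next_choke[OF cal i(2), rotated])
    with i(2) show "y \<in> through m ` {..?n}" by auto
  qed auto
  then show ?thesis by (simp add: through_def)
qed

section \<open>Divergence of the two paths\<close>

theorem proposition3p3:
  shows "\<not> (\<exists>k :: real. \<forall>v p u w q t.
           gersten_short flat_F v p u \<longrightarrow> gersten_short flat_F w q t \<longrightarrow>
           gdist flat_F v w \<le> 1 \<longrightarrow> gdist flat_F u t \<le> 1 \<longrightarrow>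
           fellow_travel flat_F k v p w q)"
proof
  assume "\<exists>k :: real. \<forall>v p u w q t.
           gersten_short flat_F v p u \<longrightarrow> gersten_short flat_F w q t \<longrightarrow>
           gdist flat_F v w \<le> 1 \<longrightarrow> gdist flat_F u t \<le> 1 \<longrightarrow>
           fellow_travel flat_F k v p w q"
  then obtain k :: real where k: "\<And>v p u w q t.
           gersten_short flat_F v p u \<Longrightarrow> gersten_short flat_F w q t \<Longrightarrow>
           gdist flat_F v w \<le> 1 \<Longrightarrow> gdist flat_F u t \<le> 1 \<Longrightarrow>
           fellow_travel flat_F k v p w q"
    by blast
  \<comment> \<open>The distance at time \<open>2 * j\<close> will be at least \<open>j\<close>;
    positivity keeps the first path away from the hexagon when it crosses the strip.\<close>
  obtain j :: nat where j: "k < real j" "0 < j"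
    using reals_Archimedean2[of "max k 0"] by auto
  note wf = wf_digraph_skeleton_flat_F
  let ?p = "chain (around j) (4 * j + 1)" and ?q = "chain (through (2 * j)) (2 * (2 * j) + 2)"
  have "{Pt 1 (2 * j) 0, Pt 0 0 (2 * j)} \<in> edges flat_F"
    using edge_sector(6)[of 0 "2 * j"] by (subst insert_commute) simp
  note vw = gdist_edge_le[OF wf this]
  have "{Pt 2 0 (2 * j), Pt 3 (2 * j) 0} \<in> edges flat_F"
    using edge_sector(6)[of 2 "2 * j"] by simp
  note ut = gdist_edge_le[OF wf this]
  have "fellow_travel flat_F k (Pt 1 (2 * j) 0) ?p (Pt 0 0 (2 * j)) ?q"
    by (rule k[OF gersten_short_around[OF j(2)] gersten_short_through vw ut])
  \<comment> \<open>At time \<open>2 * j\<close> the first path is about to cross its rung and the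
    second has just reached the hexagon.\<close>
  then have "gdist flat_F (path_vertex flat_F (Pt 1 (2 * j) 0) ?p (2 * j))
      (path_vertex flat_F (Pt 0 0 (2 * j)) ?q (2 * j)) \<le> ereal k"
    by (auto simp: fellow_travel_def)
  also have "path_vertex flat_F (Pt 1 (2 * j) 0) ?p (2 * j) = Pt 1 0 j"
    using path_vertex_chain[of "2 * j" "4 * j + 1" flat_F "around j"] by (simp add: around_def)
  also have "path_vertex flat_F (Pt 0 0 (2 * j)) ?q (2 * j) = Pt 0 0 0"
    using path_vertex_chain[of "2 * j" "2 * (2 * j) + 2" flat_F "through (2 * j)"]
    by (simp add: through_def)
  finally have "gdist flat_F (Pt 1 0 j) (Pt 0 0 0) \<le> ereal k" .
  \<comment> \<open>\<open>pot_height\<close> is \<open>j\<close> at the first vertex and 0 at the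
    second.\<close>
  from order_trans[OF lipschitz_gdist[OF wf lipschitz_pots(3)] this] j(1)
  show False by (simp add: pot_height_def)
qed

end
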